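(* For every finite poset $P$ with $|P|=k$, we have $k\le m(P)\le \binom{k+1}{2}$. Moreover, $m(P)=k$ if and only if $P$ is isomorphic to the chain $C_k$, and $m(P)=\binom{k+1}{2}$ if and only if $P$ is isomorphic to the antichain $A_k$.
   Context: All posets are finite. A subset $P'$ of a poset $(Q,\leqslant')$ is a copy of a poset $(P,\leqslant)$ if $P'$ with the order induced from $Q$ is isomorphic to $P$ (induced copy). A coloring $c$ of a poset $Q$ is proper if comparable distinct elements receive distinct colors ($q<q'$ implies $c(q)\neq c(q')$). A copy is rainbow if all its elements receive distinct colors. A poset $Q$ rainbow forces $P$ if every proper coloring of $Q$ admits a rainbow copy of $P$. $F(P)$ is the set of posets that rainbow force $P$, and $M(P)$ is the set of inclusion-minimal members of $F(P)$, i.e. posets $Q$ that rainbow force $P$ such that for every $q\in Q$ the subposet $Q\setminus\{q\}$ does not rainbow force $P$. $m(P)$ is the minimum size of a poset in $M(P)$. $C_k$ denotes the chain (totally ordered set) on $k$ elements and $A_k$ the antichain on $k$ elements. *)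

theory Defs
  imports Complex_Main "HOL-Library.Extended_Nat"
begin

text \<open>
  A poset is represented by its reflexive order relation \<open>r\<close>; its ground set is \<open>Field r\<close>, and
  \<open>(x, y) \<in> r\<close> means \<open>x \<le> y\<close>. The subposet induced on \<open>A \<subseteq> Field r\<close> is \<open>Restr r A\<close>, whose field
  is again \<open>A\<close> by reflexivity. The empty poset is allowed.
\<close>

definition finite_poset :: "'a rel \<Rightarrow> bool" where
  "finite_poset r \<longleftrightarrow> finite (Field r) \<and> Partial_order r"

definition poset_isomorphic :: "'a rel \<Rightarrow> 'b rel \<Rightarrow> bool" where
  "poset_isomorphic r s \<longleftrightarrow>
     (\<exists>f. bij_betw f (Field r) (Field s) \<and>
          (\<forall>x\<in>Field r. \<forall>y\<in>Field r. (x, y) \<in> r \<longleftrightarrow> (f x, f y) \<in> s))"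

definition is_copy :: "'b set \<Rightarrow> 'b rel \<Rightarrow> 'a rel \<Rightarrow> bool" where
  "is_copy A Q P \<longleftrightarrow> A \<subseteq> Field Q \<and> poset_isomorphic (Restr Q A) P"

definition proper_coloring :: "'b rel \<Rightarrow> ('b \<Rightarrow> 'c) \<Rightarrow> bool" where
  "proper_coloring Q c \<longleftrightarrow> (\<forall>x y. (x, y) \<in> Q \<and> x \<noteq> y \<longrightarrow> c x \<noteq> c y)"

text \<open>
  As \<open>Q\<close> is finite, natural numbers suffice as colors: any other colors can be renamed injectively.
\<close>

definition rainbow_forces :: "'b rel \<Rightarrow> 'a rel \<Rightarrow> bool" where
  "rainbow_forces Q P \<longleftrightarrow>
     (\<forall>c :: 'b \<Rightarrow> nat. proper_coloring Q c \<longrightarrow> (\<exists>A. is_copy A Q P \<and> inj_on c A))"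

text \<open>
  The posets forming \<open>F(P)\<close> and \<open>M(P)\<close> are taken with ground set in \<^typ>\<open>nat\<close>. Every finite poset is
  isomorphic to such a poset, and rainbow forcing is invariant under isomorphism.
\<close>

definition forcing_posets :: "'a rel \<Rightarrow> nat rel set" where
  "forcing_posets P = {Q. finite_poset Q \<and> rainbow_forces Q P}"

definition minimal_forcing_posets :: "'a rel \<Rightarrow> nat rel set" where
  "minimal_forcing_posets P =
     {Q \<in> forcing_posets P. \<forall>q\<in>Field Q. \<not> rainbow_forces (Restr Q (Field Q - {q})) P}"

text \<open>
  \<open>m(P)\<close>. In \<^typ>\<open>enat\<close> the infimum of a nonempty set is its minimum, and the infimum of the empty
  set is \<open>\<infinity>\<close>; so a finite value of \<open>m(P)\<close> includes the assertion that \<open>M(P)\<close> is nonempty.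
\<close>

definition min_forcing_size :: "'a rel \<Rightarrow> enat" where
  "min_forcing_size P = (INF Q\<in>minimal_forcing_posets P. enat (card (Field Q)))"

definition chain_poset :: "nat \<Rightarrow> nat rel" where
  "chain_poset k = {(i, j). i \<le> j \<and> j < k}"

definition antichain_poset :: "nat \<Rightarrow> nat rel" where
  "antichain_poset k = Id_on {..<k}"

end

theory Submission imports Defs begin

text \<open>
  Replace every element \<open>p\<close> of \<open>P\<close> by a chain of length \<open>s p\<close>. If \<open>B\<close> is a chain in \<open>P\<close> of size \<open>b\<close>,
  take \<open>s = 1\<close> on \<open>B\<close> and \<open>s = b + 1, \<dots>, k\<close> on the other elements: the colors on \<open>B\<close> are distinct
  anyway, and from each further chain one can greedily choose an element whose color is new. Hence
  \<open>m(P) \<le> (k + 1 choose 2) - (b choose 2)\<close>. The cases \<open>b = 0\<close>, \<open>b = 2\<close> and \<open>b = k\<close> give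
  the upper bound, its strictness unless \<open>P\<close> is an antichain, and \<open>m(C\<^sub>k) \<le> k\<close>.

  Conversely, if \<open>Q\<close> has fewer than \<open>(k + 1 choose 2)\<close> elements, then it has a proper coloring without
  rainbow antichain of size \<open>k\<close>: if all chains have fewer than \<open>k\<close> elements, color by height;
  otherwise give new distinct colors to a chain of size at least \<open>k\<close>, which meets each antichain at
  most once, and color the rest by induction. Finally, if \<open>Q\<close> has only \<open>k\<close> elements and forces
  \<open>P\<close>, then \<open>Q\<close> is isomorphic to \<open>P\<close>, and two incomparable elements could share a color.
\<close>

section \<open>Embeddings and minimal forcing posets\<close>

lemma finite_poset_refl: "finite_poset Q \<Longrightarrow> x \<in> Field Q \<Longrightarrow> (x, x) \<in> Q"
  by (auto simp: finite_poset_def partial_order_on_def preorder_on_def refl_on_def)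

lemma finite_poset_antisym: "finite_poset Q \<Longrightarrow> (x, y) \<in> Q \<Longrightarrow> (y, x) \<in> Q \<Longrightarrow> x = y"
  by (auto simp: finite_poset_def partial_order_on_def antisym_def)

lemma finite_poset_trans: "finite_poset Q \<Longrightarrow> (x, y) \<in> Q \<Longrightarrow> (y, z) \<in> Q \<Longrightarrow> (x, z) \<in> Q"
  by (auto simp: finite_poset_def partial_order_on_def preorder_on_def dest: transD)

lemma finite_posetI:
  assumes "finite (Field Q)"
    and "\<And>x. x \<in> Field Q \<Longrightarrow> (x, x) \<in> Q"
    and "\<And>x y. (x, y) \<in> Q \<Longrightarrow> (y, x) \<in> Q \<Longrightarrow> x = y"
    and "\<And>x y z. (x, y) \<in> Q \<Longrightarrow> (y, z) \<in> Q \<Longrightarrow> (x, z) \<in> Q"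
  shows "finite_poset Q"
  unfolding finite_poset_def partial_order_on_def preorder_on_def refl_on_def
  using assms(1,2) by (auto intro!: antisymI transI intro: assms(3,4) FieldI1 FieldI2)

lemma Field_Restr_poset:
  assumes "finite_poset Q" "A \<subseteq> Field Q"
  shows "Field (Restr Q A) = A"
  using finite_poset_refl[OF assms(1)] assms(2) by (fastforce simp: Field_def)

lemma finite_poset_Restr:
  assumes "finite_poset Q" "A \<subseteq> Field Q"
  shows "finite_poset (Restr Q A)"
proof (rule finite_posetI)
  show "finite (Field (Restr Q A))"
    using assms by (simp add: Field_Restr_poset) (auto simp: finite_poset_def intro: finite_subset)
qed (use assms finite_poset_antisym[OF assms(1)] finite_poset_trans[OF assms(1)] in
    \<open>auto simp: Field_Restr_poset subset_iff intro: finite_poset_refl\<close>)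

definition poset_embedding :: "('a \<Rightarrow> 'b) \<Rightarrow> 'a rel \<Rightarrow> 'b rel \<Rightarrow> bool" where
  "poset_embedding g P Q \<longleftrightarrow>
     g ` Field P \<subseteq> Field Q \<and> (\<forall>x\<in>Field P. \<forall>y\<in>Field P. (x, y) \<in> P \<longleftrightarrow> (g x, g y) \<in> Q)"

text \<open>Elements with equal images are related both ways in the image by reflexivity. An
  embedding reflects the order, so antisymmetry of \<open>P\<close> identifies them.\<close>

lemma poset_embedding_inj_on:
  assumes "finite_poset P" "finite_poset Q" "poset_embedding g P Q"
  shows "inj_on g (Field P)"
proof (rule inj_onI)
  fix x y assume *: "x \<in> Field P" "y \<in> Field P" "g x = g y"
  then have "(g x, g y) \<in> Q" "(g y, g x) \<in> Q"
    using assms by (auto simp: poset_embedding_def intro: finite_poset_refl)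
  with * show "x = y"
    using assms by (metis poset_embedding_def finite_poset_antisym)
qed

text \<open>The rest of the proof works with embeddings out of \<open>P\<close> instead of copies.
  The isomorphism in \<open>is_copy\<close> runs from the copy to \<open>P\<close>, so its inverse
  is the embedding, and the image of an embedding is a copy. The copy is rainbow exactly when
  \<open>c \<circ> g\<close> is injective.\<close>

lemma rainbow_forces_iff_embedding:
  assumes "finite_poset P" "finite_poset Q"
  shows "rainbow_forces Q P \<longleftrightarrow>
    (\<forall>c :: _ \<Rightarrow> nat. proper_coloring Q c \<longrightarrow>
       (\<exists>g. poset_embedding g P Q \<and> inj_on (c \<circ> g) (Field P)))"
proof -
  have "(\<exists>A. is_copy A Q P \<and> inj_on c A) \<longleftrightarrow>
        (\<exists>g. poset_embedding g P Q \<and> inj_on (c \<circ> g) (Field P))" for c :: "_ \<Rightarrow> nat"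
  proof
    assume "\<exists>A. is_copy A Q P \<and> inj_on c A"
    then obtain A f where A: "A \<subseteq> Field Q" "inj_on c A" and f: "bij_betw f A (Field P)"
      "\<And>x y. x \<in> A \<Longrightarrow> y \<in> A \<Longrightarrow> (x, y) \<in> Q \<longleftrightarrow> (f x, f y) \<in> P"
      using assms by (auto simp: is_copy_def poset_isomorphic_def Field_Restr_poset)
    let ?g = "inv_into A f"
    have g: "bij_betw ?g (Field P) A" using f(1) by (rule bij_betw_inv_into)
    have fg: "f (?g x) = x" "?g x \<in> A" if "x \<in> Field P" for x
      using that f(1) g by (auto simp: bij_betw_inv_into_right dest: bij_betwE)
    have "poset_embedding ?g P Q"
      using A(1) f(2) fg by (auto simp: poset_embedding_def)
    moreover have "inj_on (c \<circ> ?g) (Field P)"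
      using g A(2) by (auto simp: bij_betw_def intro: comp_inj_on)
    ultimately show "\<exists>g. poset_embedding g P Q \<and> inj_on (c \<circ> g) (Field P)" by blast
  next
    assume "\<exists>g. poset_embedding g P Q \<and> inj_on (c \<circ> g) (Field P)"
    then obtain g where g: "poset_embedding g P Q" "inj_on (c \<circ> g) (Field P)" by blast
    let ?A = "g ` Field P"
    have inj: "inj_on g (Field P)" using poset_embedding_inj_on assms g(1) by blast
    have sub: "?A \<subseteq> Field Q" using g(1) by (simp add: poset_embedding_def)
    have "bij_betw (inv_into (Field P) g) ?A (Field P)"
      using inj by (simp add: bij_betw_inv_into inj_on_imp_bij_betw)
    then have "is_copy ?A Q P"
      unfolding is_copy_def poset_isomorphic_def Field_Restr_poset[OF assms(2) sub]
      using sub inj g(1)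
      by (intro conjI exI[of _ "inv_into (Field P) g"]) (auto simp: poset_embedding_def)
    moreover have "inj_on c ?A" using g(2) by (rule inj_on_imageI)
    ultimately show "\<exists>A. is_copy A Q P \<and> inj_on c A" by blast
  qed
  then show ?thesis by (simp add: rainbow_forces_def)
qed

text \<open>Elements are deleted as long as the remaining subposet still forces \<open>P\<close>.
  This ends in a minimal forcing poset of no larger size, so a finite bound also shows that minimal
  forcing posets exist.\<close>

lemma min_forcing_size_le_nat:
  fixes Q :: "nat rel"
  assumes "finite_poset Q" "rainbow_forces Q P"
  shows "min_forcing_size P \<le> enat (card (Field Q))"
  using assms
proof (induction "card (Field Q)" arbitrary: Q rule: less_induct)
  case less
  show ?case
  proof (cases "Q \<in> minimal_forcing_posets P")
    case True
    then show ?thesis by (auto simp: min_forcing_size_def intro: INF_lower)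
  next
    case False
    then obtain q where q: "q \<in> Field Q" "rainbow_forces (Restr Q (Field Q - {q})) P"
      using less.prems by (auto simp: minimal_forcing_posets_def forcing_posets_def)
    let ?Q = "Restr Q (Field Q - {q})"
    have F: "Field ?Q = Field Q - {q}"
      by (rule Field_Restr_poset[OF less.prems(1)]) auto
    have "finite (Field Q)" using less.prems by (simp add: finite_poset_def)
    with q have "card (Field ?Q) < card (Field Q)" unfolding F by (meson card_Diff1_less)
    moreover have "finite_poset ?Q" using less.prems(1) by (rule finite_poset_Restr) auto
    ultimately show ?thesis using less.hyps[of ?Q] q(2)
      by (meson enat_ord_simps(1) less_imp_le order_trans)
  qed
qed

text \<open>The infimum ranges over posets on \<open>nat\<close>, but the blow-ups below live on
  pairs. The relabeling \<open>f\<close> pulls colorings of the new poset back to \<open>Q\<close>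
  and pushes embeddings forward.\<close>

lemma min_forcing_size_le:
  fixes Q :: "'b rel"
  assumes P: "finite_poset P" and Q: "finite_poset Q" and forces: "rainbow_forces Q P"
  shows "min_forcing_size P \<le> enat (card (Field Q))"
proof -
  obtain f :: "'b \<Rightarrow> nat" where f: "inj_on f (Field Q)"
    using Q finite_imp_inj_to_nat_seg by (metis finite_poset_def)
  let ?R = "map_prod f f ` Q"
  have mem: "(f x, f y) \<in> ?R \<longleftrightarrow> (x, y) \<in> Q" if "x \<in> Field Q" "y \<in> Field Q" for x y
  proof
    assume "(f x, f y) \<in> ?R"
    then obtain a b where ab: "(a, b) \<in> Q" "f x = f a" "f y = f b" by auto
    then have "a \<in> Field Q" "b \<in> Field Q" by (auto intro: FieldI1 FieldI2)
    with ab that f show "(x, y) \<in> Q" by (metis inj_onD)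
  qed force
  have F: "Field ?R = f ` Field Q"
    by (force simp: Field_def)
  have R: "finite_poset ?R"
  proof (rule finite_posetI)
    show "finite (Field ?R)" using Q by (simp add: F finite_poset_def)
  next
    show "(x, x) \<in> ?R" if "x \<in> Field ?R" for x
      using that mem finite_poset_refl[OF Q] by (auto simp: F)
  next
    fix x y assume xy: "(x, y) \<in> ?R" "(y, x) \<in> ?R"
    then have "x \<in> Field ?R" "y \<in> Field ?R" by (blast intro: FieldI1 FieldI2)+
    then obtain x' y' where "x' \<in> Field Q" "y' \<in> Field Q" "x = f x'" "y = f y'"
      unfolding F by blast
    with xy show "x = y" using mem finite_poset_antisym[OF Q] by metis
  next
    fix x y z assume xyz: "(x, y) \<in> ?R" "(y, z) \<in> ?R"
    then have "x \<in> Field ?R" "y \<in> Field ?R" "z \<in> Field ?R" by (blast intro: FieldI1 FieldI2)+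
    then obtain x' y' z' where "x' \<in> Field Q" "y' \<in> Field Q" "z' \<in> Field Q"
      "x = f x'" "y = f y'" "z = f z'" unfolding F by blast
    with xyz show "(x, z) \<in> ?R" using mem finite_poset_trans[OF Q] by metis
  qed
  have "rainbow_forces ?R P"
    unfolding rainbow_forces_iff_embedding[OF P R]
  proof (intro allI impI)
    fix c :: "nat \<Rightarrow> nat" assume c: "proper_coloring ?R c"
    have "proper_coloring Q (c \<circ> f)"
      unfolding proper_coloring_def
    proof (intro allI impI, elim conjE)
      fix x y assume "(x, y) \<in> Q" "x \<noteq> y"
      moreover from this have "x \<in> Field Q" "y \<in> Field Q" by (auto intro: FieldI1 FieldI2)
      ultimately have "(f x, f y) \<in> ?R" "f x \<noteq> f y" using mem f by (auto simp: inj_on_def)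
      then show "(c \<circ> f) x \<noteq> (c \<circ> f) y" using c by (auto simp: proper_coloring_def)
    qed
    then obtain g where "poset_embedding g P Q" "inj_on ((c \<circ> f) \<circ> g) (Field P)"
      using forces unfolding rainbow_forces_iff_embedding[OF P Q] by blast
    moreover from this have "poset_embedding (f \<circ> g) P ?R"
      unfolding poset_embedding_def F using mem by (auto simp: image_subset_iff)
    ultimately show "\<exists>h. poset_embedding h P ?R \<and> inj_on (c \<circ> h) (Field P)"
      by (metis comp_assoc)
  qed
  then have "min_forcing_size P \<le> enat (card (Field ?R))"
    using R by (intro min_forcing_size_le_nat)
  then show ?thesis using f by (simp add: F card_image)
qed

lemma le_min_forcing_sizeI:
  assumes "\<And>Q :: nat rel. finite_poset Q \<Longrightarrow> rainbow_forces Q P \<Longrightarrow> n \<le> card (Field Q)"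
  shows "enat n \<le> min_forcing_size P"
  unfolding min_forcing_size_def
  by (rule INF_greatest) (simp add: minimal_forcing_posets_def forcing_posets_def assms)

section \<open>Blowing up elements to chains\<close>

text \<open>Here \<open>c (p, i)\<close> is the \<open>i\<close>-th color on offer at
  \<open>p\<close>, and \<open>f\<close> picks one color for each element. Elements of
  \<open>D\<close> are added one by one, each offering one color more than there are earlier
  elements, so a fresh color always remains. The sizes outside \<open>B\<close> are thus
  \<open>card B + 1\<close>, \<open>card B + 2\<close> and so on. The sum is stated additively to
  avoid truncated subtraction.\<close>

lemma exists_greedy_sizes:
  fixes B D :: "'a set"
  assumes "finite D" "finite B" "B \<inter> D = {}"
  shows "\<exists>s :: 'a \<Rightarrow> nat.
    (\<forall>p\<in>B. s p = 1) \<and>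
    (\<Sum>p\<in>B \<union> D. s p) + (card B choose 2) = (card (B \<union> D) + 1) choose 2 \<and>
    (\<forall>c :: 'a \<times> nat \<Rightarrow> nat.
       (\<forall>p\<in>B \<union> D. inj_on (\<lambda>i. c (p, i)) {..<s p}) \<and> inj_on (\<lambda>p. c (p, 0)) B \<longrightarrow>
       (\<exists>f. (\<forall>p\<in>B \<union> D. f p < s p) \<and> inj_on (\<lambda>p. c (p, f p)) (B \<union> D)))"
  using assms
proof (induction D rule: finite_induct)
  case empty
  have "card B + (card B choose 2) = (card B + 1) choose 2"
    by (simp add: numeral_2_eq_2)
  moreover have "\<exists>f. (\<forall>p\<in>B. f p < (1::nat)) \<and> inj_on (\<lambda>p. c (p, f p)) B"
    if "inj_on (\<lambda>p. c (p, 0)) B" for c :: "'a \<times> nat \<Rightarrow> nat"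
    using that by (intro exI[of _ "\<lambda>_. 0"]) simp
  ultimately show ?case
    by (intro exI[of _ "\<lambda>_. 1"]) simp
next
  case (insert x D)
  let ?A = "B \<union> D"
  have x: "x \<notin> ?A" and fin: "finite ?A" using insert by auto
  obtain s :: "'a \<Rightarrow> nat" where s1: "\<forall>p\<in>B. s p = 1"
    and ssum: "(\<Sum>p\<in>?A. s p) + (card B choose 2) = (card ?A + 1) choose 2"
    and sc: "\<forall>c :: 'a \<times> nat \<Rightarrow> nat.
       (\<forall>p\<in>?A. inj_on (\<lambda>i. c (p, i)) {..<s p}) \<and> inj_on (\<lambda>p. c (p, 0)) B \<longrightarrow>
       (\<exists>f. (\<forall>p\<in>?A. f p < s p) \<and> inj_on (\<lambda>p. c (p, f p)) ?A)"
  proof -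
    have "B \<inter> D = {}" using insert.prems by auto
    from insert.IH[OF insert.prems(1) this] show thesis by (elim exE conjE) (rule that)
  qed
  let ?s = "s(x := card ?A + 1)"
  have "(\<Sum>p\<in>B \<union> insert x D. ?s p) = (card ?A + 1) + (\<Sum>p\<in>?A. s p)"
  proof -
    have "(\<Sum>p\<in>?A. ?s p) = (\<Sum>p\<in>?A. s p)" using x by (intro sum.cong) auto
    then show ?thesis using x fin by simp
  qed
  moreover have "card (B \<union> insert x D) = card ?A + 1" using x fin by simp
  ultimately have "(\<Sum>p\<in>B \<union> insert x D. ?s p) + (card B choose 2)
      = (card (B \<union> insert x D) + 1) choose 2"
    using ssum by (simp add: numeral_2_eq_2)
  moreover have "\<forall>p\<in>B. ?s p = 1" using s1 x by auto
  moreover have extend: "\<exists>f. (\<forall>p\<in>B \<union> insert x D. f p < ?s p) \<and>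
      inj_on (\<lambda>p. c (p, f p)) (B \<union> insert x D)"
    if c: "\<forall>p\<in>B \<union> insert x D. inj_on (\<lambda>i. c (p, i)) {..<?s p}" "inj_on (\<lambda>p. c (p, 0)) B"
    for c :: "'a \<times> nat \<Rightarrow> nat"
  proof -
    have "\<forall>p\<in>?A. inj_on (\<lambda>i. c (p, i)) {..<s p}"
    proof
      fix p assume "p \<in> ?A"
      then have "inj_on (\<lambda>i. c (p, i)) {..<?s p}" "p \<noteq> x" using c(1) x by blast+
      then show "inj_on (\<lambda>i. c (p, i)) {..<s p}" by simp
    qed
    then obtain f where f: "\<forall>p\<in>?A. f p < s p" "inj_on (\<lambda>p. c (p, f p)) ?A"
      using sc[rule_format, of c] c(2) by blast
    \<comment> \<open>Pigeonhole: \<open>x\<close> offers \<open>card ?A + 1\<close> distinct colors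
      and only \<open>card ?A\<close> are taken, so some index \<open>j\<close> gives a free
      color.\<close>
    have "card ((\<lambda>p. c (p, f p)) ` ?A) < card ((\<lambda>i. c (x, i)) ` {..<card ?A + 1})"
      using c(1) f(2) by (simp add: card_image)
    then have "\<not> (\<lambda>i. c (x, i)) ` {..<card ?A + 1} \<subseteq> (\<lambda>p. c (p, f p)) ` ?A"
      using fin by (meson card_mono finite_imageI not_le)
    then obtain j where j: "j < card ?A + 1" "c (x, j) \<notin> (\<lambda>p. c (p, f p)) ` ?A"
      by blast
    have "inj_on (\<lambda>p. c (p, (f(x := j)) p)) ?A \<longleftrightarrow> inj_on (\<lambda>p. c (p, f p)) ?A"
      using x by (intro inj_on_cong) auto
    then have "inj_on (\<lambda>p. c (p, (f(x := j)) p)) (insert x ?A)"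
      using f(2) j(2) x by (auto simp: inj_on_insert image_iff)
    moreover have "\<forall>p\<in>insert x ?A. (f(x := j)) p < ?s p"
      using f(1) j(1) by simp
    ultimately show ?thesis by (intro exI[of _ "f(x := j)"]) (simp only: Un_insert_right)
  qed
  ultimately show ?case
    by (intro exI[of _ ?s] conjI) (assumption+, intro allI impI, elim conjE, rule extend)
qed

text \<open>Levels are compared only within one fiber. Between fibers over distinct elements the
  order is that of \<open>P\<close>, so picking one element from each fiber always gives a copy of
  \<open>P\<close>, whatever the levels.\<close>

definition blow_up :: "'a rel \<Rightarrow> ('a \<Rightarrow> nat) \<Rightarrow> ('a \<times> nat) rel" where
  "blow_up P s = {((p, i), (q, j)). (p, q) \<in> P \<and> i < s p \<and> j < s q \<and> (p = q \<longrightarrow> i \<le> j)}"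

lemma Field_blow_up:
  assumes "finite_poset P"
  shows "Field (blow_up P s) = (SIGMA p:Field P. {..<s p})"
proof
  show "Field (blow_up P s) \<subseteq> (SIGMA p:Field P. {..<s p})"
    by (auto simp: Field_def blow_up_def)
  show "(SIGMA p:Field P. {..<s p}) \<subseteq> Field (blow_up P s)"
  proof clarify
    fix p i assume "p \<in> Field P" "i < s p"
    then have "((p, i), (p, i)) \<in> blow_up P s"
      using finite_poset_refl[OF assms] by (simp add: blow_up_def)
    then show "(p, i) \<in> Field (blow_up P s)" by (rule FieldI1)
  qed
qed

lemma finite_poset_blow_up:
  assumes "finite_poset P"
  shows "finite_poset (blow_up P s)"
proof (rule finite_posetI)
  show "finite (Field (blow_up P s))"
    using assms by (simp add: Field_blow_up finite_poset_def)
  show "(x, x) \<in> blow_up P s" if "x \<in> Field (blow_up P s)" for x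
    using that assms by (auto simp: Field_blow_up) (auto simp: blow_up_def finite_poset_refl)
  show "x = y" if "(x, y) \<in> blow_up P s" "(y, x) \<in> blow_up P s" for x y
    using that finite_poset_antisym[OF assms] by (fastforce simp: blow_up_def)
  show "(x, z) \<in> blow_up P s" if "(x, y) \<in> blow_up P s" "(y, z) \<in> blow_up P s" for x y z
  proof -
    \<comment> \<open>Levels matter only if \<open>p = r\<close>. Then antisymmetry puts all three
      points in the same fiber, where the level inequalities compose.\<close>
    obtain p i q j r l where xyz: "x = (p, i)" "y = (q, j)" "z = (r, l)"
      by (metis surj_pair)
    have "(p, r) \<in> P" "p = r \<Longrightarrow> q = p"
      using that xyz finite_poset_trans[OF assms, of p q r] finite_poset_antisym[OF assms, of q p]
      by (auto simp: blow_up_def)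
    then show ?thesis using that xyz by (auto simp: blow_up_def)
  qed
qed

text \<open>A proper coloring is injective on each fiber and on the bottom level over
  \<open>B\<close>, since both are chains in the blow-up. These are the two assumptions of the
  greedy choice. The subtraction is exact, because the fiber sizes sum to the difference.\<close>

lemma min_forcing_size_le_chain:
  assumes P: "finite_poset P" and B: "B \<subseteq> Field P" "total_on B P"
  shows "min_forcing_size P \<le> enat (((card (Field P) + 1) choose 2) - (card B choose 2))"
proof -
  have finP: "finite (Field P)" using P by (simp add: finite_poset_def)
  then have finB: "finite B" using B(1) finite_subset by blast
  have U: "B \<union> (Field P - B) = Field P" using B(1) by blast
  obtain s :: "'a \<Rightarrow> nat" where s1: "\<forall>p\<in>B. s p = 1"
    and ssum: "(\<Sum>p\<in>Field P. s p) + (card B choose 2) = (card (Field P) + 1) choose 2"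
    and sc: "\<And>c :: 'a \<times> nat \<Rightarrow> nat. (\<forall>p\<in>Field P. inj_on (\<lambda>i. c (p, i)) {..<s p}) \<Longrightarrow>
       inj_on (\<lambda>p. c (p, 0)) B \<Longrightarrow>
       \<exists>f. (\<forall>p\<in>Field P. f p < s p) \<and> inj_on (\<lambda>p. c (p, f p)) (Field P)"
    using exists_greedy_sizes[of "Field P - B" B] finP finB unfolding U by auto
  let ?Q = "blow_up P s"
  have Q: "finite_poset ?Q" using P by (rule finite_poset_blow_up)
  have "rainbow_forces ?Q P"
    unfolding rainbow_forces_iff_embedding[OF P Q]
  proof (intro allI impI)
    fix c :: "'a \<times> nat \<Rightarrow> nat" assume c: "proper_coloring ?Q c"
    have "\<forall>p\<in>Field P. inj_on (\<lambda>i. c (p, i)) {..<s p}"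
    proof
      fix p assume "p \<in> Field P"
      then have "((p, i), (p, j)) \<in> ?Q" if "i < j" "j < s p" for i j
        using that finite_poset_refl[OF P] by (simp add: blow_up_def)
      then have "c (p, i) \<noteq> c (p, j)" if "i < j" "j < s p" for i j
        using that c by (fastforce simp: proper_coloring_def)
      then show "inj_on (\<lambda>i. c (p, i)) {..<s p}"
        by (auto intro!: linorder_inj_onI)
    qed
    moreover have "inj_on (\<lambda>p. c (p, 0)) B"
    proof (rule inj_onI, rule ccontr)
      fix p q assume pq: "p \<in> B" "q \<in> B" "c (p, 0) = c (q, 0)" "p \<noteq> q"
      then have "(p, q) \<in> P \<or> (q, p) \<in> P" using B(2) by (auto simp: total_on_def)
      then have "((p, 0), (q, 0)) \<in> ?Q \<or> ((q, 0), (p, 0)) \<in> ?Q"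
        using pq s1 by (auto simp: blow_up_def)
      then show False using c pq(3,4) unfolding proper_coloring_def by (metis prod.inject)
    qed
    ultimately obtain f where f: "\<forall>p\<in>Field P. f p < s p" "inj_on (\<lambda>p. c (p, f p)) (Field P)"
      using sc by blast
    have "poset_embedding (\<lambda>p. (p, f p)) P ?Q"
      using f(1) by (auto simp: poset_embedding_def Field_blow_up[OF P]) (auto simp: blow_up_def)
    then show "\<exists>g. poset_embedding g P ?Q \<and> inj_on (c \<circ> g) (Field P)"
      using f(2) by (auto simp: comp_def)
  qed
  then have "min_forcing_size P \<le> enat (card (Field ?Q))"
    by (rule min_forcing_size_le[OF P Q])
  also have "card (Field ?Q) = (\<Sum>p\<in>Field P. s p)"
    using finP by (simp add: Field_blow_up[OF P])
  also have "\<dots> = ((card (Field P) + 1) choose 2) - (card B choose 2)" using ssum by linarith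
  finally show ?thesis .
qed

section \<open>Lower bounds\<close>

lemma obtain_injective_coloring:
  assumes "finite_poset Q"
  obtains c :: "'b \<Rightarrow> nat" where "inj_on c (Field (Q :: 'b rel))" "proper_coloring Q c"
proof -
  obtain c :: "'b \<Rightarrow> nat" where "inj_on c (Field Q)"
    using assms finite_imp_inj_to_nat_seg by (metis finite_poset_def)
  then show thesis
    using that[of c] by (auto simp: proper_coloring_def inj_on_def intro: FieldI1 FieldI2)
qed

text \<open>Forcing yields an embedding only once some proper coloring is supplied; an injective one
  serves.\<close>

lemma card_le_if_rainbow_forces:
  assumes P: "finite_poset P" and Q: "finite_poset Q" and "rainbow_forces Q P"
  shows "card (Field P) \<le> card (Field Q)"
proof -
  obtain c :: "_ \<Rightarrow> nat" where "proper_coloring Q c" using obtain_injective_coloring[OF Q] .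
  then obtain g where g: "poset_embedding g P Q"
    using assms(3) unfolding rainbow_forces_iff_embedding[OF P Q] by blast
  then show ?thesis using poset_embedding_inj_on[OF P Q g] Q
    by (auto simp: poset_embedding_def finite_poset_def intro: card_inj_on_le)
qed

text \<open>With equal sizes every embedding is onto, so a rainbow copy needs all colors of
  \<open>Q\<close> to be distinct. This fails for a proper coloring in which two incomparable
  elements share a color.\<close>

lemma total_if_rainbow_forces_card_eq:
  assumes P: "finite_poset P" and Q: "finite_poset Q" and forces: "rainbow_forces Q P"
    and card: "card (Field Q) = card (Field P)"
  shows "total_on (Field P) P"
  unfolding total_on_def
proof (intro ballI impI, rule ccontr)
  fix x y assume xy: "x \<in> Field P" "y \<in> Field P" "x \<noteq> y" "\<not> ((x, y) \<in> P \<or> (y, x) \<in> P)"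
  have finQ: "finite (Field Q)" using Q by (simp add: finite_poset_def)
  have onto: "g ` Field P = Field Q" if "poset_embedding g P Q" for g
    using poset_embedding_inj_on[OF P Q that] that finQ card
    by (intro card_subset_eq) (auto simp: poset_embedding_def card_image)
  obtain c :: "_ \<Rightarrow> nat" where c: "inj_on c (Field Q)" "proper_coloring Q c"
    using obtain_injective_coloring[OF Q] .
  then obtain g where g: "poset_embedding g P Q"
    using forces unfolding rainbow_forces_iff_embedding[OF P Q] by blast
  have gxy: "g x \<in> Field Q" "g y \<in> Field Q" "(g x, g y) \<notin> Q" "(g y, g x) \<notin> Q"
    using g xy by (auto simp: poset_embedding_def)
  \<comment> \<open>Starting from an injective coloring, the only new coincidence is between the
    incomparable points \<open>g x\<close> and \<open>g y\<close>, so \<open>?d\<close> stays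
    proper.\<close>
  let ?d = "c(g y := c (g x))"
  have "proper_coloring Q ?d"
    unfolding proper_coloring_def
  proof (intro allI impI, elim conjE)
    fix u v assume uv: "(u, v) \<in> Q" "u \<noteq> v"
    then have "u \<in> Field Q" "v \<in> Field Q" by (auto intro: FieldI1 FieldI2)
    with uv gxy c(1) show "?d u \<noteq> ?d v" by (auto simp: inj_on_def)
  qed
  then obtain h where h: "poset_embedding h P Q" "inj_on (?d \<circ> h) (Field P)"
    using forces unfolding rainbow_forces_iff_embedding[OF P Q] by blast
  have "inj_on ?d (Field Q)" using inj_on_imageI[OF h(2)] onto[OF h(1)] by simp
  then have "g x = g y" using gxy(1,2) by (auto dest!: inj_onD[of _ _ "g x" "g y"])
  then show False using poset_embedding_inj_on[OF P Q g] xy by (auto dest: inj_onD)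
qed

text \<open>The height of \<open>x\<close> is the largest size of a chain in \<open>S\<close> with
  all elements below or equal to \<open>x\<close>. The chain \<open>{x}\<close> makes it positive,
  and the bound on chains keeps it below \<open>k\<close>.\<close>

lemma exists_height_coloring:
  assumes Q: "finite_poset Q" and S: "S \<subseteq> Field Q"
    and chains: "\<And>C. C \<subseteq> S \<Longrightarrow> total_on C Q \<Longrightarrow> card C < k"
  shows "\<exists>h :: _ \<Rightarrow> nat. h ` S \<subseteq> {0<..<k} \<and>
    (\<forall>x\<in>S. \<forall>y\<in>S. (x, y) \<in> Q \<longrightarrow> x \<noteq> y \<longrightarrow> h x < h y)"
proof -
  have finS: "finite S" using Q S finite_subset by (auto simp: finite_poset_def)
  define K where "K x = {C. C \<subseteq> S \<and> total_on C Q \<and> (\<forall>z\<in>C. (z, x) \<in> Q)}" for x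
  define h where "h x = Max (card ` K x)" for x
  have fin: "finite (card ` K x)" for x
    using finS by (auto simp: K_def intro: finite_subset[of _ "Pow S"])
  have sing: "{x} \<in> K x" if "x \<in> S" for x
    using that S finite_poset_refl[OF Q] by (auto simp: K_def)
  have ge: "card C \<le> h x" if "C \<in> K x" for C x
    using that fin by (simp add: h_def)
  have attained: "\<exists>C\<in>K x. h x = card C" if "x \<in> S" for x
    using Max_in[OF fin, of x] sing[OF that] by (auto simp: h_def)
  have "h x \<in> {0<..<k}" if "x \<in> S" for x
    using ge[OF sing[OF that]] attained[OF that] chains by (auto simp: K_def)
  moreover have "h x < h y" if xy: "x \<in> S" "y \<in> S" "(x, y) \<in> Q" "x \<noteq> y" for x y
  proof -
    obtain C where C: "C \<in> K x" "h x = card C" using attained[OF xy(1)] by blast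
    have below: "(z, y) \<in> Q" if "z \<in> C" for z
      using that C(1) xy(3) finite_poset_trans[OF Q] by (auto simp: K_def)
    \<comment> \<open>A longest chain below \<open>x\<close> can be extended by \<open>y\<close>: if
      \<open>y\<close> were already in it, then \<open>y\<close> would lie below \<open>x\<close> as
      well as above it.\<close>
    have "y \<notin> C" using C(1) xy finite_poset_antisym[OF Q] by (auto simp: K_def)
    moreover have "insert y C \<in> K y"
      using C(1) below xy(2) S finite_poset_refl[OF Q] by (auto simp: K_def total_on_def)
    moreover have "finite C" using C(1) finS by (auto simp: K_def intro: finite_subset)
    ultimately show ?thesis using ge[of "insert y C" y] C(2) by simp
  qed
  ultimately show ?thesis by (intro exI[of _ h]) blast
qed

text \<open>The induction on \<open>k\<close> removes a chain, so the claim is about subsets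
  \<open>S\<close> of a fixed poset. \<open>Restr Q A \<subseteq> Id\<close> says that
  \<open>A\<close> is an antichain.\<close>

lemma exists_coloring_without_rainbow_antichain:
  assumes Q: "finite_poset (Q :: 'b rel)" and "S \<subseteq> Field Q" "card S < (k + 1) choose 2"
  shows "\<exists>c :: 'b \<Rightarrow> nat. (\<forall>x\<in>S. \<forall>y\<in>S. (x, y) \<in> Q \<longrightarrow> x \<noteq> y \<longrightarrow> c x \<noteq> c y) \<and>
    (\<forall>A. A \<subseteq> S \<longrightarrow> Restr Q A \<subseteq> Id \<longrightarrow> inj_on c A \<longrightarrow> card A < k)"
  using assms(2,3)
proof (induction k arbitrary: S)
  case 0
  then show ?case by (simp add: numeral_2_eq_2)
next
  case (Suc k)
  have finS: "finite S" using Q Suc.prems finite_subset by (auto simp: finite_poset_def)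
  show ?case
  proof (cases "\<forall>C. C \<subseteq> S \<longrightarrow> total_on C Q \<longrightarrow> card C < Suc k")
    case True
    then obtain h :: "'b \<Rightarrow> nat" where h: "h ` S \<subseteq> {0<..<Suc k}"
      "\<And>x y. x \<in> S \<Longrightarrow> y \<in> S \<Longrightarrow> (x, y) \<in> Q \<Longrightarrow> x \<noteq> y \<Longrightarrow> h x < h y"
      using exists_height_coloring[OF Q Suc.prems(1)] by metis
    \<comment> \<open>Heights take only the \<open>k\<close> values from 1 to \<open>k\<close>, so
      no rainbow set at all has \<open>k + 1\<close> elements.\<close>
    have "card A < Suc k" if "A \<subseteq> S" "inj_on h A" for A
    proof -
      have "card A \<le> card {0<..<Suc k}" using that h(1) by (intro card_inj_on_le) auto
      then show ?thesis by simp
    qed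
    moreover have "h x \<noteq> h y" if "x \<in> S" "y \<in> S" "(x, y) \<in> Q" "x \<noteq> y" for x y
      using h(2)[OF that] by simp
    ultimately show ?thesis by (intro exI[of _ h]) blast
  next
    case False
    then obtain C where C: "C \<subseteq> S" "total_on C Q" "Suc k \<le> card C" by (auto simp: not_less)
    have finC: "finite C" using C(1) finS finite_subset by blast
    \<comment> \<open>Removing at least \<open>k + 1\<close> elements matches the step from
      \<open>k + 2 choose 2\<close> down to \<open>k + 1 choose 2\<close>, so the induction
      hypothesis applies to \<open>S - C\<close>.\<close>
    have "card (S - C) = card S - card C" using C(1) finC by (simp add: card_Diff_subset)
    moreover have "card S < (k + 1 choose 2) + Suc k"
      using Suc.prems(2) by (simp add: numeral_2_eq_2)
    moreover have "card C \<le> card S" using C(1) finS by (rule card_mono[rotated])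
    ultimately have "card (S - C) < (k + 1) choose 2"
      using C(3) by linarith
    moreover have "S - C \<subseteq> Field Q" using Suc.prems(1) by blast
    ultimately obtain c :: "'b \<Rightarrow> nat" where
      c: "\<And>x y. x \<in> S - C \<Longrightarrow> y \<in> S - C \<Longrightarrow> (x, y) \<in> Q \<Longrightarrow> x \<noteq> y \<Longrightarrow> c x \<noteq> c y"
      and rainbow: "\<And>A. A \<subseteq> S - C \<Longrightarrow> Restr Q A \<subseteq> Id \<Longrightarrow> inj_on c A \<Longrightarrow> card A < k"
      using Suc.IH[of "S - C"] by blast
    obtain g :: "'b \<Rightarrow> nat" where g: "inj_on g C"
      using finC finite_imp_inj_to_nat_seg by metis
    \<comment> \<open>Odd colors on the chain and even colors elsewhere keep the two palettes
      disjoint.\<close>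
    define d where "d x = (if x \<in> C then 2 * g x + 1 else 2 * c x)" for x
    have d: "d x \<noteq> d y" if "x \<in> S" "y \<in> S" "(x, y) \<in> Q" "x \<noteq> y" for x y
    proof (cases "x \<in> C \<longleftrightarrow> y \<in> C")
      case True
      then show ?thesis using that c[of x y] g by (auto simp: d_def inj_on_def)
    next
      case False
      then have "even (d x) \<noteq> even (d y)" by (auto simp: d_def)
      then show ?thesis by auto
    qed
    have "card A < Suc k" if A: "A \<subseteq> S" "Restr Q A \<subseteq> Id" "inj_on d A" for A
    proof -
      have "inj_on c (A - C)" using A(3) by (auto simp: inj_on_def d_def)
      then have "card (A - C) < k" using A by (intro rainbow) auto
      moreover have "card (A \<inter> C) \<le> 1"
        using A(2) C(2) finC by (auto simp: card_le_Suc0_iff_eq total_on_def)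
      moreover have "card A = card (A \<inter> C) + card (A - C)"
        using A(1) finS by (metis card_Int_Diff finite_subset)
      ultimately show ?thesis by simp
    qed
    then show ?thesis using d by (intro exI[of _ d]) blast
  qed
qed

text \<open>In a smaller \<open>Q\<close>, the coloring just constructed would have to admit a
  rainbow copy of \<open>P\<close>, which is an antichain of the excluded size.\<close>

lemma antichain_forcing_card_ge:
  assumes P: "finite_poset P" and anti: "P \<subseteq> Id"
    and Q: "finite_poset Q" and forces: "rainbow_forces Q P"
  shows "(card (Field P) + 1) choose 2 \<le> card (Field Q)"
proof (rule ccontr)
  assume "\<not> ?thesis"
  then have "card (Field Q) < (card (Field P) + 1) choose 2" by simp
  then obtain c :: "_ \<Rightarrow> nat" where
    c: "\<forall>x\<in>Field Q. \<forall>y\<in>Field Q. (x, y) \<in> Q \<longrightarrow> x \<noteq> y \<longrightarrow> c x \<noteq> c y"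
    and rainbow: "\<forall>A. A \<subseteq> Field Q \<longrightarrow> Restr Q A \<subseteq> Id \<longrightarrow> inj_on c A \<longrightarrow> card A < card (Field P)"
    using exists_coloring_without_rainbow_antichain[OF Q order_refl] by meson
  have "proper_coloring Q c" using c by (auto simp: proper_coloring_def intro: FieldI1 FieldI2)
  then obtain g where g: "poset_embedding g P Q" "inj_on (c \<circ> g) (Field P)"
    using forces unfolding rainbow_forces_iff_embedding[OF P Q] by blast
  have "card (g ` Field P) < card (Field P)"
    using g anti by (intro rainbow[rule_format] inj_on_imageI) (auto simp: poset_embedding_def)
  then show False using poset_embedding_inj_on[OF P Q g(1)] by (simp add: card_image)
qed

section \<open>Chains and antichains\<close>

lemma Field_chain_poset: "Field (chain_poset k) = {..<k}"
  by (auto simp: Field_def chain_poset_def)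

lemma isomorphic_chain_iff_total:
  assumes P: "finite_poset P"
  shows "poset_isomorphic P (chain_poset (card (Field P))) \<longleftrightarrow> total_on (Field P) P"
proof
  assume "poset_isomorphic P (chain_poset (card (Field P)))"
  then obtain f where f: "bij_betw f (Field P) {..<card (Field P)}"
    "\<And>x y. x \<in> Field P \<Longrightarrow> y \<in> Field P \<Longrightarrow> (x, y) \<in> P \<longleftrightarrow> (f x, f y) \<in> chain_poset (card (Field P))"
    by (auto simp: poset_isomorphic_def Field_chain_poset)
  show "total_on (Field P) P"
    using f bij_betwE[OF f(1)] by (fastforce simp: total_on_def chain_poset_def)
next
  assume total: "total_on (Field P) P"
  have finP: "finite (Field P)" using P by (simp add: finite_poset_def)
  \<comment> \<open>In a chain the position of an element is the number of its strict predecessors;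
    this count is the isomorphism.\<close>
  define D where "D x = {y. (y, x) \<in> P \<and> y \<noteq> x}" for x
  define f where "f x = card (D x)" for x
  have finD: "finite (D x)" for x
    using finP by (rule finite_subset[rotated]) (auto simp: D_def intro: FieldI1)
  have less: "f x < f y" if "(x, y) \<in> P" "x \<noteq> y" for x y
  proof -
    have "D x \<subset> D y"
      using that finite_poset_trans[OF P] finite_poset_antisym[OF P] unfolding D_def by blast
    then show ?thesis using finD by (simp add: f_def psubset_card_mono)
  qed
  have iff: "(x, y) \<in> P \<longleftrightarrow> f x \<le> f y" if "x \<in> Field P" "y \<in> Field P" for x y
  proof (cases "x = y")
    case False
    then have "(x, y) \<in> P \<or> (y, x) \<in> P" using that total by (simp add: total_on_def)
    with False show ?thesis using less[of x y] less[of y x] by fastforce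
  qed (simp add: that finite_poset_refl[OF P])
  have "inj_on f (Field P)"
    using iff finite_poset_antisym[OF P] by (intro inj_onI) auto
  moreover have sub: "f ` Field P \<subseteq> {..<card (Field P)}"
  proof clarsimp
    fix x assume "x \<in> Field P"
    then have "D x \<subset> Field P" by (auto simp: D_def intro: FieldI1)
    then show "f x < card (Field P)" using finP by (simp add: f_def psubset_card_mono)
  qed
  ultimately have "bij_betw f (Field P) {..<card (Field P)}"
    unfolding bij_betw_def by (simp add: card_image card_subset_eq)
  then show "poset_isomorphic P (chain_poset (card (Field P)))"
    unfolding poset_isomorphic_def Field_chain_poset
    using iff sub by (intro exI[of _ f]) (auto simp: chain_poset_def)
qed

lemma Field_antichain_poset: "Field (antichain_poset k) = {..<k}"
  by (auto simp: Field_def antichain_poset_def)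

lemma isomorphic_antichain_iff:
  assumes P: "finite_poset P"
  shows "poset_isomorphic P (antichain_poset (card (Field P))) \<longleftrightarrow> P \<subseteq> Id"
proof
  assume "poset_isomorphic P (antichain_poset (card (Field P)))"
  then obtain f where f: "bij_betw f (Field P) {..<card (Field P)}"
    "\<And>x y. x \<in> Field P \<Longrightarrow> y \<in> Field P \<Longrightarrow> (x, y) \<in> P \<Longrightarrow> f x = f y"
    unfolding poset_isomorphic_def Field_antichain_poset by (auto simp: antichain_poset_def Id_on_iff)
  then show "P \<subseteq> Id"
    by (metis FieldI1 FieldI2 IdI bij_betw_imp_inj_on inj_onD subrelI)
next
  assume anti: "P \<subseteq> Id"
  \<comment> \<open>Any bijection of the ground sets is an isomorphism of antichains.\<close>
  obtain f where f: "bij_betw f (Field P) {..<card (Field P)}"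
    using P ex_bij_betw_finite_nat[of "Field P"] by (auto simp: finite_poset_def atLeast0LessThan)
  have "(x, y) \<in> P \<longleftrightarrow> (f x, f y) \<in> Id_on {..<card (Field P)}"
    if "x \<in> Field P" "y \<in> Field P" for x y
    using that anti f finite_poset_refl[OF P] bij_betwE[OF f]
    by (auto simp: bij_betw_def inj_on_def Id_on_iff)
  then show "poset_isomorphic P (antichain_poset (card (Field P)))"
    unfolding poset_isomorphic_def Field_antichain_poset
    using f by (auto simp: antichain_poset_def)
qed

section \<open>The bounds on m(P) and their equality cases\<close>

theorem theorem1p4:
  fixes P :: "'a rel" and k :: nat
  assumes "finite_poset P" and "card (Field P) = k"
  shows "enat k \<le> min_forcing_size P \<and> min_forcing_size P \<le> enat ((k + 1) choose 2) \<and>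
         (min_forcing_size P = enat k \<longleftrightarrow> poset_isomorphic P (chain_poset k)) \<and>
         (min_forcing_size P = enat ((k + 1) choose 2) \<longleftrightarrow> poset_isomorphic P (antichain_poset k))"
proof (intro conjI)
  note P = assms(1)
  show lower: "enat k \<le> min_forcing_size P"
    using card_le_if_rainbow_forces[OF P] assms(2) by (intro le_min_forcing_sizeI) auto
  show upper: "min_forcing_size P \<le> enat ((k + 1) choose 2)"
    using min_forcing_size_le_chain[OF P, of "{}"] assms(2) by (simp add: numeral_2_eq_2)
  show "min_forcing_size P = enat k \<longleftrightarrow> poset_isomorphic P (chain_poset k)"
    unfolding isomorphic_chain_iff_total[OF P, unfolded assms(2)]
  proof
    assume "total_on (Field P) P"
    \<comment> \<open>The whole of \<open>P\<close> serves as the chain, and the difference of the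
      two binomials is \<open>k\<close>.\<close>
    then have "min_forcing_size P \<le> enat (((k + 1) choose 2) - (k choose 2))"
      using min_forcing_size_le_chain[OF P order_refl] assms(2) by simp
    then show "min_forcing_size P = enat k"
      using lower by (simp add: numeral_2_eq_2)
  next
    assume eq: "min_forcing_size P = enat k"
    show "total_on (Field P) P"
    proof (rule ccontr)
      assume "\<not> total_on (Field P) P"
      \<comment> \<open>Size exactly \<open>k\<close> would make \<open>P\<close> total, so the
        lower bound improves by one.\<close>
      then have "k + 1 \<le> card (Field Q)" if "finite_poset Q" "rainbow_forces Q P" for Q :: "nat rel"
        using card_le_if_rainbow_forces[OF P that] total_if_rainbow_forces_card_eq[OF P that] assms(2)
        by (cases "card (Field Q) = k") auto
      then have "enat (k + 1) \<le> min_forcing_size P" by (rule le_min_forcing_sizeI)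
      then show False using eq by simp
    qed
  qed
  show "min_forcing_size P = enat ((k + 1) choose 2) \<longleftrightarrow> poset_isomorphic P (antichain_poset k)"
    unfolding isomorphic_antichain_iff[OF P, unfolded assms(2)]
  proof
    assume "P \<subseteq> Id"
    then have "enat ((k + 1) choose 2) \<le> min_forcing_size P"
      using antichain_forcing_card_ge[OF P] assms(2) by (intro le_min_forcing_sizeI) auto
    then show "min_forcing_size P = enat ((k + 1) choose 2)" using upper by simp
  next
    assume eq: "min_forcing_size P = enat ((k + 1) choose 2)"
    show "P \<subseteq> Id"
    proof (rule ccontr)
      assume "\<not> P \<subseteq> Id"
      then obtain x y where xy: "(x, y) \<in> P" "x \<noteq> y" by auto
      then have sub: "{x, y} \<subseteq> Field P" by (auto intro: FieldI1 FieldI2)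
      \<comment> \<open>A chain of two elements lowers the upper bound by
        \<open>2 choose 2 = 1\<close>.\<close>
      have "total_on {x, y} P" using xy by (auto simp: total_on_def)
      with sub have "min_forcing_size P \<le> enat (((k + 1) choose 2) - 1)"
        using min_forcing_size_le_chain[OF P sub] xy(2) assms(2) by (simp add: numeral_2_eq_2)
      \<comment> \<open>Subtracting 1 on natural numbers is a strict decrease only if the binomial
        is positive.\<close>
      moreover have "card (Field P) \<noteq> 0"
        using sub assms(1) card_eq_0_iff[of "Field P"] by (auto simp: finite_poset_def)
      then have "0 < (k + 1) choose 2" using assms(2) by (simp add: zero_less_binomial)
      ultimately show False unfolding eq enat_ord_simps by linarith
    qed
  qed
qed

end
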